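(* Let $\mathcal{X}\subset\mathbb{R}^n$ be either an open subset or a smooth submanifold of $\mathbb{R}^n$, let $f$ be a locally Lipschitz vector field on $\mathcal{X}$, and consider the dynamical system $\Sigma:\ \dot x=f(x)$, $x\in\mathcal{X}$, with solutions $\phi(t,x_0)$. Let $\Gamma\subset\mathcal{O}\subset\mathcal{X}$ be two closed sets which are positively invariant for $\Sigma$. (Local version) $\Gamma$ is asymptotically stable for $\Sigma$ if the following conditions hold: (i) $\Gamma$ is asymptotically stable relative to $\mathcal{O}$; (ii) $\mathcal{O}$ is locally stable near $\Gamma$; (iii) $\mathcal{O}$ is locally attractive near $\Gamma$; (iv) if $\Gamma$ is unbounded, then $\Sigma$ is locally uniformly bounded near $\Gamma$. (Global version) $\Gamma$ is globally asymptotically stable for $\Sigma$ if the following conditions hold: (i) $\Gamma$ is globally asymptotically stable relative to $\mathcal{O}$; (ii) $\mathcal{O}$ is locally stable near $\Gamma$; (iii) $\mathcal{O}$ is globally attractive; (iv) if $\Gamma$ is unbounded, then $\Sigma$ is locally uniformly bounded near $\Gamma$; (v) all trajectories of $\Sigma$ are bounded.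
   Context: Notation: $\mathbb{R}^+=[0,+\infty)$; $\phi(t,x_0)$ is the unique solution of $\dot x=f(x)$ with $\phi(0,x_0)=x_0$; for $I\subset\mathbb{R}$ and $S\subset\mathcal{X}$, $\phi(I,S)=\{\phi(t,x_0):t\in I,x_0\in S\}$. For a nonempty closed set $S$, $\|x\|_S=\inf\{\|x-y\|:y\in S\}$; $B_\alpha(x)=\{y\in\mathcal{X}:\|y-x\|<\alpha\}$ and $B_\alpha(S)=\{y\in\mathcal{X}:\|y\|_S<\alpha\}$. $\mathcal{N}(S)$ denotes an open subset of $\mathcal{X}$ containing $S$ (a neighbourhood of $S$). "Bounded" for trajectories refers to $t\ge 0$. Statements involving $t\to\infty$ or $\phi(\mathbb{R}^+,\cdot)$ presuppose that the solutions concerned are defined for all $t\ge0$. A set $S$ is positively invariant if $\phi(t,x_0)\in S$ for all $x_0\in S$ and all $t\ge0$. Let $\Gamma\subset\mathcal{X}$ be closed and positively invariant. - $\Gamma$ is stable if for all $\varepsilon>0$ there is a neighbourhood $\mathcal{N}(\Gamma)$ with $\phi(\mathbb{R}^+,\mathcal{N}(\Gamma))\subset B_\varepsilon(\Gamma)$. - $\Gamma$ is attractive if there is a neighbourhood $\mathcal{N}(\Gamma)$ such that $\lim_{t\to\infty}\|\phi(t,x_0)\|_\Gamma=0$ for all $x_0\in\mathcal{N}(\Gamma)$; it is globally attractive if this holds with $\mathcal{N}(\Gamma)=\mathcal{X}$. - $\Gamma$ is [globally] asymptotically stable if it is stable and [globally] attractive. Relative notions: for $\mathcal{O}\subset\mathcal{X}$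 with $\mathcal{O}\cap\Gamma\ne\emptyset$, $\Gamma$ is stable relative to $\mathcal{O}$ if for every $\varepsilon>0$ there is $\mathcal{N}(\Gamma)$ with $\phi(\mathbb{R}^+,\mathcal{N}(\Gamma)\cap\mathcal{O})\subset B_\varepsilon(\Gamma)$. Relative [global] attractivity and relative [global] asymptotic stability are obtained in the same way, by restricting initial conditions to lie in $\mathcal{O}$. For positively invariant sets $\Gamma\subset\mathcal{O}\subset\mathcal{X}$: - $\mathcal{O}$ is locally stable near $\Gamma$ if for all $x\in\Gamma$, all $c>0$ and all $\varepsilon>0$ there exists $\delta>0$ such that for all $x_0\in B_\delta(\Gamma)$ and all $t>0$, whenever $\phi([0,t],x_0)\subset B_c(x)$ one has $\phi([0,t],x_0)\subset B_\varepsilon(\mathcal{O})$. - $\mathcal{O}$ is locally attractive near $\Gamma$ if there is a neighbourhood $\mathcal{N}(\Gamma)$ such that, for all $x_0\in\mathcal{N}(\Gamma)$, $\phi(t,x_0)\to\mathcal{O}$ (i.e., $\|\phi(t,x_0)\|_{\mathcal{O}}\to0$) as $t\to+\infty$. $\Sigma$ is locally uniformly bounded near $\Gamma$ if for each $x\in\Gamma$ there exist positive scalars $\lambda$ and $m$ such that $\phi(\mathbb{R}^+,B_\lambda(x))\subset B_m(x)$. *)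

theory Defs
  imports "HOL-Analysis.Analysis"
begin

text \<open>On an open set, \<open>C_diff k S g\<close> says that \<open>g\<close> is of class \<open>C^k\<close>: derivatives are taken
  direction by direction, so that the type does not change along the recursion.\<close>

primrec C_diff :: "nat \<Rightarrow> 'a::euclidean_space set \<Rightarrow> ('a \<Rightarrow> 'b::euclidean_space) \<Rightarrow> bool" where
  "C_diff 0 S g \<longleftrightarrow> continuous_on S g"
| "C_diff (Suc k) S g \<longleftrightarrow>
     (\<forall>x\<in>S. g differentiable (at x)) \<and> (\<forall>v. C_diff k S (\<lambda>x. frechet_derivative g (at x) v))"

definition smooth_on :: "'a::euclidean_space set \<Rightarrow> ('a \<Rightarrow> 'b::euclidean_space) \<Rightarrow> bool" where
  "smooth_on S g \<longleftrightarrow> (\<forall>k. C_diff k S g)"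

text \<open>Embedded submanifolds without boundary, by local charts of the ambient space that
  flatten \<open>X\<close> onto a linear subspace.\<close>

definition smooth_submanifold :: "'a::euclidean_space set \<Rightarrow> bool" where
  "smooth_submanifold X \<longleftrightarrow>
     (\<exists>d. \<forall>p\<in>X. \<exists>U V (g :: 'a \<Rightarrow> 'a) h L.
        open U \<and> p \<in> U \<and> open V \<and> homeomorphism U V g h \<and> smooth_on U g \<and> smooth_on V h \<and>
        subspace L \<and> dim L = d \<and> g ` (X \<inter> U) = V \<inter> L)"

text \<open>Velocities of smooth curves in \<open>X\<close>; if \<open>X\<close> is open, this is the whole space.\<close>

definition tangent_space :: "'a::euclidean_space set \<Rightarrow> 'a \<Rightarrow> 'a set" where
  "tangent_space X p =
     {v. \<exists>(e::real) \<gamma>. 0 < e \<and> smooth_on {-e<..<e} \<gamma> \<and> \<gamma> ` {-e<..<e} \<subseteq> X \<and> \<gamma> 0 = p \<and>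
           (\<gamma> has_vector_derivative v) (at 0)}"

text \<open>\<open>local_lipschitz\<close> is the library notion for time-dependent right-hand sides; here the right-hand
  side does not depend on time.\<close>

definition loc_lipschitz_vector_field :: "'a::euclidean_space set \<Rightarrow> ('a \<Rightarrow> 'a) \<Rightarrow> bool" where
  "loc_lipschitz_vector_field X f \<longleftrightarrow>
     (\<forall>x\<in>X. f x \<in> tangent_space X x) \<and> local_lipschitz (UNIV :: real set) X (\<lambda>_. f)"

definition ivp_solution ::
  "'a::euclidean_space set \<Rightarrow> ('a \<Rightarrow> 'a) \<Rightarrow> 'a \<Rightarrow> real set \<Rightarrow> (real \<Rightarrow> 'a) \<Rightarrow> bool" where
  "ivp_solution X f x0 I u \<longleftrightarrow>
     is_interval I \<and> 0 \<in> I \<and> u 0 = x0 \<and>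
     (\<forall>t\<in>I. u t \<in> X \<and> (u has_vector_derivative f (u t)) (at t within I))"

text \<open>The maximal interval of existence and the maximal solution \<open>\<phi>(t,x0)\<close> on it. The latter is
  well defined because solutions of locally Lipschitz equations are unique.\<close>

definition ex_ivl :: "'a::euclidean_space set \<Rightarrow> ('a \<Rightarrow> 'a) \<Rightarrow> 'a \<Rightarrow> real set" where
  "ex_ivl X f x0 = \<Union>{I. \<exists>u. ivp_solution X f x0 I u}"

definition flow :: "'a::euclidean_space set \<Rightarrow> ('a \<Rightarrow> 'a) \<Rightarrow> real \<Rightarrow> 'a \<Rightarrow> 'a" where
  "flow X f t x0 = (THE y. \<exists>I u. ivp_solution X f x0 I u \<and> t \<in> I \<and> u t = y)"

text \<open>\<open>\<phi>(I,S) \<subseteq> A\<close>, including the presupposition that the solutions concerned are defined on \<open>I\<close>.\<close>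

definition flow_into ::
  "'a::euclidean_space set \<Rightarrow> ('a \<Rightarrow> 'a) \<Rightarrow> real set \<Rightarrow> 'a set \<Rightarrow> 'a set \<Rightarrow> bool" where
  "flow_into X f I S A \<longleftrightarrow> (\<forall>x0\<in>S. \<forall>t\<in>I. t \<in> ex_ivl X f x0 \<and> flow X f t x0 \<in> A)"

text \<open>\<open>\<phi>(t,x0) \<rightarrow> S\<close> as \<open>t \<rightarrow> \<infinity>\<close>, including the presupposition that the solution exists for all
  \<open>t \<ge> 0\<close>.\<close>

definition tends_to_set ::
  "'a::euclidean_space set \<Rightarrow> ('a \<Rightarrow> 'a) \<Rightarrow> 'a \<Rightarrow> 'a set \<Rightarrow> bool" where
  "tends_to_set X f x0 S \<longleftrightarrow>
     {0..} \<subseteq> ex_ivl X f x0 \<and> ((\<lambda>t. infdist (flow X f t x0) S) \<longlongrightarrow> 0) at_top"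

text \<open>No completeness is built in here: the solution has to stay in \<open>S\<close> as long as it exists.\<close>

definition positively_invariant :: "'a::euclidean_space set \<Rightarrow> ('a \<Rightarrow> 'a) \<Rightarrow> 'a set \<Rightarrow> bool" where
  "positively_invariant X f S \<longleftrightarrow>
     (\<forall>x0\<in>S. \<forall>t\<in>ex_ivl X f x0. 0 \<le> t \<longrightarrow> flow X f t x0 \<in> S)"

definition all_trajectories_bounded :: "'a::euclidean_space set \<Rightarrow> ('a \<Rightarrow> 'a) \<Rightarrow> bool" where
  "all_trajectories_bounded X f \<longleftrightarrow>
     (\<forall>x0\<in>X. bounded ((\<lambda>t. flow X f t x0) ` (ex_ivl X f x0 \<inter> {0..})))"

definition pt_ball :: "'a::euclidean_space set \<Rightarrow> real \<Rightarrow> 'a \<Rightarrow> 'a set" where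
  "pt_ball X r x = {y\<in>X. norm (y - x) < r}"

definition set_ball :: "'a::euclidean_space set \<Rightarrow> real \<Rightarrow> 'a set \<Rightarrow> 'a set" where
  "set_ball X r S = {y\<in>X. infdist y S < r}"

definition nbhd :: "'a::euclidean_space set \<Rightarrow> 'a set \<Rightarrow> 'a set \<Rightarrow> bool" where
  "nbhd X S N \<longleftrightarrow> openin (top_of_set X) N \<and> S \<subseteq> N"

definition stable :: "'a::euclidean_space set \<Rightarrow> ('a \<Rightarrow> 'a) \<Rightarrow> 'a set \<Rightarrow> bool" where
  "stable X f \<Gamma> \<longleftrightarrow> (\<forall>\<epsilon>>0. \<exists>N. nbhd X \<Gamma> N \<and> flow_into X f {0..} N (set_ball X \<epsilon> \<Gamma>))"

definition attractive :: "'a::euclidean_space set \<Rightarrow> ('a \<Rightarrow> 'a) \<Rightarrow> 'a set \<Rightarrow> bool" where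
  "attractive X f \<Gamma> \<longleftrightarrow> (\<exists>N. nbhd X \<Gamma> N \<and> (\<forall>x0\<in>N. tends_to_set X f x0 \<Gamma>))"

definition globally_attractive :: "'a::euclidean_space set \<Rightarrow> ('a \<Rightarrow> 'a) \<Rightarrow> 'a set \<Rightarrow> bool" where
  "globally_attractive X f \<Gamma> \<longleftrightarrow> (\<forall>x0\<in>X. tends_to_set X f x0 \<Gamma>)"

definition asymptotically_stable :: "'a::euclidean_space set \<Rightarrow> ('a \<Rightarrow> 'a) \<Rightarrow> 'a set \<Rightarrow> bool" where
  "asymptotically_stable X f \<Gamma> \<longleftrightarrow> stable X f \<Gamma> \<and> attractive X f \<Gamma>"

definition globally_asymptotically_stable ::
  "'a::euclidean_space set \<Rightarrow> ('a \<Rightarrow> 'a) \<Rightarrow> 'a set \<Rightarrow> bool" where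
  "globally_asymptotically_stable X f \<Gamma> \<longleftrightarrow> stable X f \<Gamma> \<and> globally_attractive X f \<Gamma>"

definition stable_rel :: "'a::euclidean_space set \<Rightarrow> ('a \<Rightarrow> 'a) \<Rightarrow> 'a set \<Rightarrow> 'a set \<Rightarrow> bool" where
  "stable_rel X f \<O> \<Gamma> \<longleftrightarrow>
     (\<forall>\<epsilon>>0. \<exists>N. nbhd X \<Gamma> N \<and> flow_into X f {0..} (N \<inter> \<O>) (set_ball X \<epsilon> \<Gamma>))"

definition attractive_rel :: "'a::euclidean_space set \<Rightarrow> ('a \<Rightarrow> 'a) \<Rightarrow> 'a set \<Rightarrow> 'a set \<Rightarrow> bool" where
  "attractive_rel X f \<O> \<Gamma> \<longleftrightarrow>
     (\<exists>N. nbhd X \<Gamma> N \<and> (\<forall>x0\<in>N \<inter> \<O>. tends_to_set X f x0 \<Gamma>))"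

definition globally_attractive_rel ::
  "'a::euclidean_space set \<Rightarrow> ('a \<Rightarrow> 'a) \<Rightarrow> 'a set \<Rightarrow> 'a set \<Rightarrow> bool" where
  "globally_attractive_rel X f \<O> \<Gamma> \<longleftrightarrow> (\<forall>x0\<in>X \<inter> \<O>. tends_to_set X f x0 \<Gamma>)"

definition asymptotically_stable_rel ::
  "'a::euclidean_space set \<Rightarrow> ('a \<Rightarrow> 'a) \<Rightarrow> 'a set \<Rightarrow> 'a set \<Rightarrow> bool" where
  "asymptotically_stable_rel X f \<O> \<Gamma> \<longleftrightarrow> stable_rel X f \<O> \<Gamma> \<and> attractive_rel X f \<O> \<Gamma>"

definition globally_asymptotically_stable_rel ::
  "'a::euclidean_space set \<Rightarrow> ('a \<Rightarrow> 'a) \<Rightarrow> 'a set \<Rightarrow> 'a set \<Rightarrow> bool" where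
  "globally_asymptotically_stable_rel X f \<O> \<Gamma> \<longleftrightarrow>
     stable_rel X f \<O> \<Gamma> \<and> globally_attractive_rel X f \<O> \<Gamma>"

definition locally_stable_near ::
  "'a::euclidean_space set \<Rightarrow> ('a \<Rightarrow> 'a) \<Rightarrow> 'a set \<Rightarrow> 'a set \<Rightarrow> bool" where
  "locally_stable_near X f \<O> \<Gamma> \<longleftrightarrow>
     (\<forall>x\<in>\<Gamma>. \<forall>c>0. \<forall>\<epsilon>>0. \<exists>\<delta>>0. \<forall>x0\<in>set_ball X \<delta> \<Gamma>. \<forall>t>0.
        flow_into X f {0..t} {x0} (pt_ball X c x) \<longrightarrow>
        flow_into X f {0..t} {x0} (set_ball X \<epsilon> \<O>))"

definition locally_attractive_near ::
  "'a::euclidean_space set \<Rightarrow> ('a \<Rightarrow> 'a) \<Rightarrow> 'a set \<Rightarrow> 'a set \<Rightarrow> bool" where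
  "locally_attractive_near X f \<O> \<Gamma> \<longleftrightarrow>
     (\<exists>N. nbhd X \<Gamma> N \<and> (\<forall>x0\<in>N. tends_to_set X f x0 \<O>))"

definition locally_uniformly_bounded_near ::
  "'a::euclidean_space set \<Rightarrow> ('a \<Rightarrow> 'a) \<Rightarrow> 'a set \<Rightarrow> bool" where
  "locally_uniformly_bounded_near X f \<Gamma> \<longleftrightarrow>
     (\<forall>x\<in>\<Gamma>. \<exists>l>0. \<exists>m>0. flow_into X f {0..} (pt_ball X l x) (pt_ball X m x))"

end

theory Submission
  imports Defs
begin

text \<open>If stability fails at \<open>x \<in> \<Gamma>\<close>, there are trajectories starting at \<open>x\<^sub>n \<rightarrow> x\<close> which leave the
  \<open>\<delta>\<close>-neighbourhood of \<open>\<Gamma>\<close> for the last time at \<open>s\<^sub>n\<close> before reaching distance \<open>\<epsilon>\<close> at \<open>t\<^sub>n\<close>.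
  They stay in a fixed ball, so by local stability of \<open>\<O>\<close> the points \<open>\<phi>(s\<^sub>n, x\<^sub>n)\<close> accumulate at some
  \<open>p \<in> \<O>\<close> close to \<open>\<Gamma>\<close>. By stability relative to \<open>\<O>\<close> the trajectory of \<open>p\<close> keeps distance less than
  \<open>\<epsilon>/2\<close>, so continuous dependence forces \<open>t\<^sub>n - s\<^sub>n \<rightarrow> \<infinity>\<close>; but it also tends to \<open>\<Gamma>\<close>, so the
  approximating trajectories come back within \<open>\<delta>\<close> after \<open>s\<^sub>n\<close>, a contradiction. Attractivity follows
  from stability by looking at a limit point of a bounded trajectory. Only completeness in
  forward time of the trajectories concerned is used, which the hypotheses provide, so no existence
  theorem for solutions on \<open>X\<close> is needed.\<close>

section \<open>Compactness and crossing times\<close>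

text \<open>By contradiction: otherwise pairs \<open>y n\<close>, \<open>z n\<close> at distance
  tending to 0 have difference quotients above every bound; a subsequence of both converges to one
  \<open>p\<close> in \<open>K\<close>, against the Lipschitz constant near \<open>p\<close>. The
  point \<open>z\<close> ranges over \<open>X\<close> and not just \<open>K\<close>, because a
  neighbouring solution leaves the compact trajectory it is compared with.\<close>

lemma lipschitz_around_compact:
  fixes f :: "'a::euclidean_space \<Rightarrow> 'b::euclidean_space"
  assumes lip: "local_lipschitz (UNIV :: real set) X (\<lambda>_. f)"
    and "compact K" "K \<subseteq> X"
  obtains r L where "r > 0" "L \<ge> 0"
    "\<And>y z. y \<in> K \<Longrightarrow> z \<in> X \<Longrightarrow> dist y z \<le> r \<Longrightarrow> dist (f y) (f z) \<le> L * dist y z"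
proof -
  have "\<exists>n::nat. \<forall>y\<in>K. \<forall>z\<in>X. dist y z \<le> inverse (Suc n) \<longrightarrow> dist (f y) (f z) \<le> n * dist y z"
  proof (rule ccontr)
    assume "\<not> ?thesis"
    then have "\<forall>n::nat. \<exists>y z. y \<in> K \<and> z \<in> X \<and> dist y z \<le> inverse (Suc n) \<and>
        dist (f y) (f z) > n * dist y z"
      by (meson not_le)
    then obtain y z where yz: "\<And>n::nat. y n \<in> K" "\<And>n. z n \<in> X"
      "\<And>n. dist (y n) (z n) \<le> inverse (Suc n)"
      "\<And>n. dist (f (y n)) (f (z n)) > n * dist (y n) (z n)"
      by metis
    obtain p r where p: "p \<in> K" "strict_mono (r :: nat \<Rightarrow> nat)" "(y \<circ> r) \<longlonglongrightarrow> p"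
    proof (rule seq_compactE[OF compact_imp_seq_compact[OF assms(2)]])
      show "\<forall>n. y n \<in> K" using yz(1) by simp
    qed
    have "p \<in> X" using p(1) assms(3) by blast
    obtain u L where u: "u > 0" "L-lipschitz_on (cball p u \<inter> X) f"
    proof (rule local_lipschitzE[OF lip UNIV_I \<open>p \<in> X\<close>])
      fix u L assume uL: "0 < u" "\<And>s. s \<in> cball (0::real) u \<inter> UNIV \<Longrightarrow> L-lipschitz_on (cball p u \<inter> X) f"
      then show thesis using uL(2)[of 0] that[of u L] by simp
    qed
    have zlim: "(z \<circ> r) \<longlonglongrightarrow> p"
    proof (rule Lim_transform2[OF p(3)])
      have "(\<lambda>n. dist (y n) (z n)) \<longlonglongrightarrow> 0"
        by (rule tendsto_sandwich[OF _ _ tendsto_const LIMSEQ_inverse_real_of_nat])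
          (use yz(3) in auto)
      from LIMSEQ_subseq_LIMSEQ[OF this p(2)]
      show "(\<lambda>n. (y \<circ> r) n - (z \<circ> r) n) \<longlonglongrightarrow> 0"
        by (simp add: o_def dist_norm tendsto_norm_zero_iff)
    qed
    have "\<forall>\<^sub>F n in sequentially. dist ((y \<circ> r) n) p < u" "\<forall>\<^sub>F n in sequentially. dist ((z \<circ> r) n) p < u"
      using tendstoD[OF p(3) u(1)] tendstoD[OF zlim u(1)] .
    moreover have "\<forall>\<^sub>F n in sequentially. real n \<ge> L"
      by (rule eventually_sequentiallyI[of "nat \<lceil>L\<rceil>"]) linarith
    ultimately have "\<forall>\<^sub>F n in sequentially. False"
    proof eventually_elim
      case (elim n)
      have "dist (f (y (r n))) (f (z (r n))) \<le> L * dist (y (r n)) (z (r n))"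
        by (rule lipschitz_onD[OF u(2)]) (use elim yz assms(3) in \<open>auto simp: dist_commute\<close>)
      also have "\<dots> \<le> real (r n) * dist (y (r n)) (z (r n))"
        using elim seq_suble[OF p(2), of n] by (intro mult_right_mono) auto
      finally show ?case using yz(4)[of "r n"] by simp
    qed
    then show False by simp
  qed
  then obtain n :: nat where n:
    "\<forall>y\<in>K. \<forall>z\<in>X. dist y z \<le> inverse (Suc n) \<longrightarrow> dist (f y) (f z) \<le> n * dist y z" ..
  show thesis
  proof (rule that[of "inverse (Suc n)" n])
    show "dist (f y) (f z) \<le> n * dist y z"
      if "y \<in> K" "z \<in> X" "dist y z \<le> inverse (Suc n)" for y z
      using n that by blast
  qed (simp_all del: of_nat_Suc)
qed

text \<open>\<open>t\<close> is the first time at level \<open>c\<close> or above, and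
  \<open>s\<close> the last time before it at level \<open>a\<close> or below; both are attained
  since the preimages are compact. It serves to stop two solutions when they first separate, and to
  cut out the final stretch of an escape.\<close>

lemma crossing_times:
  fixes g :: "real \<Rightarrow> real"
  assumes cont: "continuous_on {0..b} g" and "0 \<le> b" "g 0 \<le> a" "a < c" "c \<le> g b"
  obtains s t where "0 \<le> s" "s < t" "t \<le> b" "g s \<le> a" "g t = c"
    "\<And>r. 0 \<le> r \<Longrightarrow> r \<le> t \<Longrightarrow> g r \<le> c" "\<And>r. s < r \<Longrightarrow> r \<le> t \<Longrightarrow> a < g r"
proof -
  have "compact ({0..b} \<inter> g -` {c..})"
    using continuous_closed_preimage[OF cont closed_atLeastAtMost closed_atLeast]
    by (simp add: compact_eq_bounded_closed bounded_Int)
  moreover have "b \<in> {0..b} \<inter> g -` {c..}" using assms by auto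
  ultimately obtain t where t: "t \<in> {0..b} \<inter> g -` {c..}"
      and tmin: "\<And>r. r \<in> {0..b} \<inter> g -` {c..} \<Longrightarrow> t \<le> r"
    using compact_attains_inf[of "{0..b} \<inter> g -` {c..}"] by blast
  \<comment> \<open>The value \<open>c\<close> is taken somewhere in \<open>{0..t}\<close>, and
    minimality of \<open>t\<close> leaves only \<open>t\<close> itself.\<close>
  obtain r where r: "0 \<le> r" "r \<le> t" "g r = c"
    using IVT'[of g 0 c t] assms t continuous_on_subset[OF cont, of "{0..t}"] by auto
  with tmin[of r] t have gt: "g t = c" by auto
  have le: "g r \<le> c" if "0 \<le> r" "r \<le> t" for r
    using tmin[of r] that t gt by (cases "c \<le> g r") auto
  have "compact ({0..t} \<inter> g -` {..a})"
    using continuous_closed_preimage[OF continuous_on_subset[OF cont, of "{0..t}"]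
      closed_atLeastAtMost closed_atMost] t
    by (simp add: compact_eq_bounded_closed bounded_Int)
  moreover have "0 \<in> {0..t} \<inter> g -` {..a}" using assms t by auto
  ultimately obtain s where s: "s \<in> {0..t} \<inter> g -` {..a}"
      and smax: "\<And>r. r \<in> {0..t} \<inter> g -` {..a} \<Longrightarrow> r \<le> s"
    using compact_attains_sup[of "{0..t} \<inter> g -` {..a}"] by blast
  have "s \<noteq> t" using s gt assms by auto
  show thesis
  proof (rule that[of s t])
    show "a < g r" if "s < r" "r \<le> t" for r
      using smax[of r] that s by (cases "g r \<le> a") auto
  qed (use s t gt le \<open>s \<noteq> t\<close> in auto)
qed

text \<open>A neighbourhood of an unbounded \<open>\<Gamma>\<close> may become arbitrarily thin far
  away. Inside a compact \<open>C\<close> it cannot: the part of \<open>C\<close> outside the open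
  set is compact and disjoint from the closed \<open>\<Gamma>\<close>, hence at positive distance
  from it.\<close>

lemma nbhd_thick_on_compact:
  fixes C :: "'a::euclidean_space set"
  assumes "compact C" "closed \<Gamma>" "\<Gamma> \<noteq> {}" "nbhd X \<Gamma> N"
  obtains d where "d > 0" "\<And>y. y \<in> X \<Longrightarrow> y \<in> C \<Longrightarrow> infdist y \<Gamma> \<le> d \<Longrightarrow> y \<in> N"
proof -
  obtain G where G: "open G" "N = X \<inter> G" "\<Gamma> \<subseteq> G"
    using assms(4) unfolding nbhd_def openin_open by blast
  have "compact (C - G)" "(C - G) \<inter> \<Gamma> = {}" using G assms by (auto intro: compact_diff)
  from separate_compact_closed[OF this(1) assms(2) this(2)]
  obtain d where d: "d > 0" "\<And>y z. y \<in> C - G \<Longrightarrow> z \<in> \<Gamma> \<Longrightarrow> d \<le> dist y z" by blast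
  have "d \<le> infdist y \<Gamma>" if "y \<in> C - G" for y
    unfolding infdist_notempty[OF assms(3)] by (rule cINF_greatest) (use assms d that in auto)
  then show thesis using d(1) G by (intro that[of "d/2"]) force+
qed

text \<open>\<open>S \<noteq> {}\<close> matters, as \<open>infdist\<close> to the empty set is 0 by
  default.\<close>

lemma tendsto_infdist_zero_in:
  assumes "closed S" "S \<noteq> {}" "y \<longlonglongrightarrow> p" "(\<lambda>n. infdist (y n) S) \<longlonglongrightarrow> 0"
  shows "p \<in> S"
proof -
  have "(\<lambda>n. infdist (y n) S) \<longlonglongrightarrow> infdist p S" using assms(3) by (rule tendsto_infdist)
  with assms(4) have "infdist p S = 0" using LIMSEQ_unique by blast
  with assms show ?thesis by (simp add: in_closed_iff_infdist_zero)
qed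

section \<open>Solutions and their continuous dependence on the initial point\<close>

lemma ivp_solution_subset:
  assumes "ivp_solution X f x0 I u" "is_interval J" "J \<subseteq> I" "0 \<in> J"
  shows "ivp_solution X f x0 J u"
  using assms unfolding ivp_solution_def
  by (auto intro: has_vector_derivative_within_subset[OF _ assms(3)])

lemma ivp_solution_interval:
  assumes "ivp_solution X f x0 I u" "t \<in> I"
  shows "{0..t} \<subseteq> I"
proof
  fix s assume "s \<in> {0..t}"
  moreover have "is_interval I" "0 \<in> I" using assms(1) by (simp_all add: ivp_solution_def)
  ultimately show "s \<in> I" using mem_is_interval_1_I[of I 0 t s] assms(2) by simp
qed

lemma ivp_solution_continuous:
  assumes "ivp_solution X f x0 I u"
  shows "continuous_on I u"
  using assms unfolding ivp_solution_def continuous_on_eq_continuous_within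
  by (auto intro: has_vector_derivative_continuous)

text \<open>Gronwall's inequality in differential form: \<open>e\<^sup>-\<^sup>2\<^sup>L\<^sup>t\<close> times the squared distance of the
  solutions is nonincreasing.\<close>

lemma ivp_solution_dist_growth:
  fixes f :: "'a::euclidean_space \<Rightarrow> 'a"
  assumes u: "ivp_solution X f x0 {0..T} u" and v: "ivp_solution X f y0 {0..T} v"
    and "0 \<le> T"
    and L: "\<And>t. t \<in> {0..T} \<Longrightarrow> dist (f (u t)) (f (v t)) \<le> L * dist (u t) (v t)"
  shows "dist (u T) (v T) \<le> exp (L * T) * dist x0 y0"
proof -
  define w where "w t = u t - v t" for t
  define h where "h t = exp (- 2 * L * t) * (w t \<bullet> w t)" for t
  have "h T \<le> h 0"
  proof (rule DERIV_nonpos_imp_decreasing_open[OF \<open>0 \<le> T\<close>])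
    show "continuous_on {0..T} h"
      unfolding h_def w_def
      by (intro continuous_intros ivp_solution_continuous[OF u] ivp_solution_continuous[OF v])
    fix t assume t: "0 < t" "t < T"
    \<comment> \<open>Only interior times matter for monotonicity; there the derivative within the
      interval is two-sided.\<close>
    have at: "at t within {0..T} = at t" using t by (intro at_within_interior) auto
    have "(w has_vector_derivative (f (u t) - f (v t))) (at t)"
      using u v t at unfolding ivp_solution_def w_def
      by (intro has_vector_derivative_diff) (metis atLeastAtMost_iff less_imp_le)+
    then have "((\<lambda>t. w t \<bullet> w t) has_real_derivative 2 * (w t \<bullet> (f (u t) - f (v t)))) (at t)"
      unfolding has_vector_derivative_def has_field_derivative_def
      by (auto intro!: derivative_eq_intros simp: inner_commute algebra_simps)
    then have "(h has_real_derivative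
        exp (- 2 * L * t) * (2 * (w t \<bullet> (f (u t) - f (v t))) - 2 * L * (w t \<bullet> w t))) (at t)"
      unfolding h_def by (auto intro!: derivative_eq_intros simp: algebra_simps)
    moreover have "w t \<bullet> (f (u t) - f (v t)) \<le> L * (w t \<bullet> w t)"
    proof -
      have "w t \<bullet> (f (u t) - f (v t)) \<le> norm (w t) * norm (f (u t) - f (v t))"
        by (rule norm_cauchy_schwarz)
      also have "\<dots> \<le> norm (w t) * (L * norm (w t))"
        using L[of t] t by (intro mult_left_mono) (auto simp: dist_norm w_def)
      also have "\<dots> = L * (w t \<bullet> w t)" by (simp add: dot_square_norm power2_eq_square)
      finally show ?thesis .
    qed
    ultimately show "\<exists>y. (h has_real_derivative y) (at t) \<and> y \<le> 0"
      by (intro exI conjI) (assumption, simp add: mult_nonneg_nonpos)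
  qed
  then have "w T \<bullet> w T \<le> exp (2 * L * T) * (w 0 \<bullet> w 0)"
    unfolding h_def by (simp add: exp_minus field_simps)
  then have "(norm (w T))\<^sup>2 \<le> (exp (L * T) * norm (w 0))\<^sup>2"
    by (simp add: dot_square_norm power_mult_distrib mult.assoc flip: exp_double)
  then have "norm (w T) \<le> exp (L * T) * norm (w 0)"
    by (rule power2_le_imp_le) simp
  then show ?thesis using u v by (simp add: w_def dist_norm ivp_solution_def)
qed

text \<open>The growth estimate holds while \<open>v\<close> stays within \<open>r\<close> of the
  trajectory of \<open>u\<close>. Stopping at the first time the distance reaches \<open>c\<close>
  makes it applicable, and it then shows that the distance is still below \<open>c\<close>.\<close>

lemma ivp_solution_continuous_dependence:
  fixes f :: "'a::euclidean_space \<Rightarrow> 'a"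
  assumes lip: "local_lipschitz (UNIV :: real set) X (\<lambda>_. f)"
    and u: "ivp_solution X f x0 {0..T} u" and "0 \<le> T" "0 < e"
  obtains d where "d > 0"
    "\<And>y0 v t. ivp_solution X f y0 {0..T} v \<Longrightarrow> dist x0 y0 < d \<Longrightarrow> t \<in> {0..T} \<Longrightarrow> dist (u t) (v t) < e"
proof -
  have "compact (u ` {0..T})" "u ` {0..T} \<subseteq> X"
    using u ivp_solution_continuous[OF u] by (auto intro: compact_continuous_image simp: ivp_solution_def)
  then obtain r L where rL: "r > 0" "L \<ge> 0"
    "\<And>y z. y \<in> u ` {0..T} \<Longrightarrow> z \<in> X \<Longrightarrow> dist y z \<le> r \<Longrightarrow> dist (f y) (f z) \<le> L * dist y z"
    using lipschitz_around_compact[OF lip] by metis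
  \<comment> \<open>Up to distance \<open>c\<close> the Lipschitz bound is valid, and
    \<open>c \<le> e\<close>. The factor in \<open>d\<close> compensates the largest possible growth
    \<open>exp (L * T)\<close>.\<close>
  define c where "c = min r e"
  define d where "d = exp (- L * T) * c"
  have "c > 0" using rL assms by (simp add: c_def)
  show thesis
  proof (rule that[of d])
    show "d > 0" using \<open>c > 0\<close> by (simp add: d_def)
    have "d \<le> c" unfolding d_def using rL(2) assms(3) \<open>c > 0\<close> by (simp add: mult_le_cancel_right1)
    fix y0 v b assume v: "ivp_solution X f y0 {0..T} v" and y0: "dist x0 y0 < d" and b: "b \<in> {0..T}"
    show "dist (u b) (v b) < e"
    proof (rule ccontr)
      assume "\<not> dist (u b) (v b) < e"
      then have ge: "c \<le> dist (u b) (v b)" by (simp add: c_def)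
      have cont: "continuous_on {0..b} (\<lambda>t. dist (u t) (v t))"
        using b by (intro continuous_intros continuous_on_subset[OF ivp_solution_continuous[OF u]]
          continuous_on_subset[OF ivp_solution_continuous[OF v]]) auto
      have init: "dist (u 0) (v 0) \<le> dist x0 y0" using u v by (simp add: ivp_solution_def)
      \<comment> \<open>The lower level is \<open>dist x0 y0\<close>, which is below
        \<open>c\<close> because \<open>d \<le> c\<close>.\<close>
      obtain s t where st: "0 \<le> s" "s < t" "t \<le> b" "dist (u t) (v t) = c"
        "\<And>r. 0 \<le> r \<Longrightarrow> r \<le> t \<Longrightarrow> dist (u r) (v r) \<le> c"
        using crossing_times[OF cont _ init _ ge] b y0 \<open>d \<le> c\<close>
        by (metis atLeastAtMost_iff order_less_le_trans)
      have "dist (u t) (v t) \<le> exp (L * t) * dist x0 y0"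
      proof (rule ivp_solution_dist_growth[where X = X and f = f])
        show "ivp_solution X f x0 {0..t} u" "ivp_solution X f y0 {0..t} v"
          using st b by (auto intro!: ivp_solution_subset[OF u] ivp_solution_subset[OF v])
        fix r assume "r \<in> {0..t}"
        then show "dist (f (u r)) (f (v r)) \<le> L * dist (u r) (v r)"
          using st(5)[of r] st(3) b v by (intro rL(3)) (auto simp: c_def ivp_solution_def)
      qed (use st in auto)
      also have "\<dots> \<le> exp (L * T) * dist x0 y0"
        using st b rL(2) by (intro mult_right_mono) (auto intro: mult_left_mono)
      also have "\<dots> < exp (L * T) * d" using y0 by simp
      also have "\<dots> = c" by (simp add: d_def exp_minus)
      finally show False using st by simp
    qed
  qed
qed

section \<open>The flow in forward time\<close>

context
  fixes X :: "'a::euclidean_space set" and f :: "'a \<Rightarrow> 'a"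
  assumes lip: "local_lipschitz (UNIV :: real set) X (\<lambda>_. f)"
begin

text \<open>Uniqueness is continuous dependence with equal initial points: two solutions are closer
  than every \<open>e\<close>. This makes the description operator in \<open>flow\<close> well
  defined for nonnegative times.\<close>

lemma flow_eq_solution:
  assumes u: "ivp_solution X f x0 I u" and "t \<in> I" "0 \<le> t"
  shows "flow X f t x0 = u t"
proof -
  have "v t = u t" if v: "ivp_solution X f x0 J v" "t \<in> J" for J v
  proof -
    have sub: "{0..t} \<subseteq> J" "{0..t} \<subseteq> I"
      using ivp_solution_interval v u \<open>t \<in> I\<close> by blast+
    have u': "ivp_solution X f x0 {0..t} u" and v': "ivp_solution X f x0 {0..t} v"
      using sub assms by (auto intro!: ivp_solution_subset[OF u] ivp_solution_subset[OF v(1)])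
    have "dist (u t) (v t) < e" if e: "e > 0" for e
    proof -
      obtain d where "d > 0" "\<And>y0 v s. ivp_solution X f y0 {0..t} v \<Longrightarrow> dist x0 y0 < d \<Longrightarrow>
          s \<in> {0..t} \<Longrightarrow> dist (u s) (v s) < e"
        using ivp_solution_continuous_dependence[OF lip u' \<open>0 \<le> t\<close> e] by blast
      then show ?thesis using v' \<open>0 \<le> t\<close> by simp
    qed
    then show ?thesis by (metis dist_pos_lt less_irrefl)
  qed
  then show ?thesis unfolding flow_def using assms by (intro the_equality) blast+
qed

text \<open>\<open>ex_ivl\<close> is a union over possibly different solutions, so the flow has to
  be glued: on each compact interval it agrees with one solution, by uniqueness.\<close>

lemma flow_solution:
  assumes "{0..} \<subseteq> ex_ivl X f x0"
  shows "ivp_solution X f x0 {0..} (\<lambda>t. flow X f t x0)"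
proof -
  have *: "\<exists>u. ivp_solution X f x0 {0..t} u \<and> (\<forall>s\<in>{0..t}. flow X f s x0 = u s)" if "0 \<le> t" for t
  proof -
    have "t \<in> ex_ivl X f x0" using assms that by auto
    then obtain I u where Iu: "ivp_solution X f x0 I u" "t \<in> I" unfolding ex_ivl_def by blast
    have "{0..t} \<subseteq> I" using Iu by (rule ivp_solution_interval)
    then have sol: "ivp_solution X f x0 {0..t} u"
      using that by (intro ivp_solution_subset[OF Iu(1)]) auto
    then have "flow X f s x0 = u s" if "s \<in> {0..t}" for s
      using flow_eq_solution[OF sol that] that by simp
    with sol show ?thesis by blast
  qed
  have "flow X f t x0 \<in> X \<and>
      ((\<lambda>t. flow X f t x0) has_vector_derivative f (flow X f t x0)) (at t within {0..})" if "0 \<le> t" for t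
  proof -
    \<comment> \<open>A solution on \<open>{0..t+1}\<close> also covers times right of
      \<open>t\<close>, so its derivative at \<open>t\<close> is the one within
      \<open>{0..}\<close>.\<close>
    have "0 \<le> t + 1" using that by simp
    from *[OF this]
    obtain u where u: "ivp_solution X f x0 {0..t+1} u" "\<forall>s\<in>{0..t+1}. flow X f s x0 = u s"
      by blast
    have "(u has_vector_derivative f (u t)) (at t within {0..t+1})" "u t \<in> X"
      using u that by (auto simp: ivp_solution_def)
    moreover have "at t within {0..t+1} = at t within {0..}"
      using that by (intro at_within_nhd[of t "{t-1<..<t+1}"]) auto
    ultimately have "(u has_vector_derivative f (u t)) (at t within {0..})" "u t \<in> X" by auto
    then have "((\<lambda>t. flow X f t x0) has_vector_derivative f (u t)) (at t within {0..})" "u t \<in> X"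
      using u(2) that
      by (auto intro: has_vector_derivative_transform_within[where d = 1 and f = u] simp: dist_real_def)
    then show ?thesis using u(2) that by auto
  qed
  moreover have "flow X f 0 x0 = x0" using *[of 0] by (auto simp: ivp_solution_def)
  ultimately show ?thesis by (auto simp: ivp_solution_def is_interval_1)
qed

lemma
  assumes "{0..} \<subseteq> ex_ivl X f x0"
  shows flow_in: "0 \<le> t \<Longrightarrow> flow X f t x0 \<in> X"
    and flow_zero: "flow X f 0 x0 = x0"
    and continuous_on_flow: "continuous_on {0..} (\<lambda>t. flow X f t x0)"
proof -
  note sol = flow_solution[OF assms]
  show "flow X f t x0 \<in> X" if "0 \<le> t" using sol that unfolding ivp_solution_def by simp
  show "flow X f 0 x0 = x0" using sol unfolding ivp_solution_def by simp
  show "continuous_on {0..} (\<lambda>t. flow X f t x0)" using sol by (rule ivp_solution_continuous)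
qed

text \<open>Semigroup property: the time-shifted curve solves the equation from
  \<open>flow X f s x0\<close>, and uniqueness identifies it with the flow.\<close>

lemma
  assumes "{0..} \<subseteq> ex_ivl X f x0" "0 \<le> s"
  shows ex_ivl_flow: "{0..} \<subseteq> ex_ivl X f (flow X f s x0)"
    and flow_flow: "0 \<le> t \<Longrightarrow> flow X f t (flow X f s x0) = flow X f (s + t) x0"
proof -
  let ?u = "\<lambda>t. flow X f (s + t) x0"
  have "(?u has_vector_derivative f (?u t)) (at t within {0..})" if "0 \<le> t" for t
  proof -
    have "((\<lambda>t. flow X f t x0) has_vector_derivative f (?u t)) (at (s + t) within {0..})"
      using flow_solution[OF assms(1)] assms that by (auto simp: ivp_solution_def)
    then have "((\<lambda>t. flow X f t x0) has_vector_derivative f (?u t)) (at (s + t) within (+) s ` {0..})"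
      by (rule has_vector_derivative_within_subset) (use assms in auto)
    then have "(((\<lambda>t. flow X f t x0) \<circ> (+) s) has_vector_derivative 1 *\<^sub>R f (?u t)) (at t within {0..})"
      by (intro vector_diff_chain_within) (auto intro!: derivative_eq_intros)
    then show ?thesis by (simp add: o_def)
  qed
  then have sol: "ivp_solution X f (flow X f s x0) {0..} ?u"
    using flow_in[OF assms(1)] assms by (auto simp: ivp_solution_def is_interval_1)
  then show "{0..} \<subseteq> ex_ivl X f (flow X f s x0)" unfolding ex_ivl_def by blast
  show "flow X f t (flow X f s x0) = ?u t" if "0 \<le> t"
    using flow_eq_solution[OF sol] that by auto
qed

lemma flow_continuous_dependence:
  assumes "{0..} \<subseteq> ex_ivl X f x0" "0 \<le> T" "0 < e"
  obtains d where "d > 0"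
    "\<And>y0 t. {0..} \<subseteq> ex_ivl X f y0 \<Longrightarrow> dist x0 y0 < d \<Longrightarrow> 0 \<le> t \<Longrightarrow> t \<le> T \<Longrightarrow>
       dist (flow X f t x0) (flow X f t y0) < e"
proof -
  have restr: "ivp_solution X f y {0..T} (\<lambda>t. flow X f t y)" if "{0..} \<subseteq> ex_ivl X f y" for y
    using ivp_solution_subset[OF flow_solution[OF that], of "{0..T}"] assms by auto
  obtain d where d: "d > 0" "\<And>y0 v t. ivp_solution X f y0 {0..T} v \<Longrightarrow> dist x0 y0 < d \<Longrightarrow>
      t \<in> {0..T} \<Longrightarrow> dist (flow X f t x0) (v t) < e"
    using ivp_solution_continuous_dependence[OF lip restr[OF assms(1)] assms(2,3)] by blast
  show thesis
    by (rule that[OF d(1) d(2)[OF restr]]) auto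
qed

section \<open>Stability near a single point\<close>

text \<open>\<open>conf\<close> is what bounded \<open>\<Gamma>\<close> and local uniform
  boundedness have in common: a trajectory remains in a fixed ball whenever it is within distance 1
  of \<open>\<Gamma>\<close>. With \<open>\<epsilon> \<le> 1\<close> this covers all times up to the
  first exit.\<close>

lemma stable_near_point:
  assumes \<Gamma>: "closed \<Gamma>" "\<Gamma> \<subseteq> \<O>" and \<O>: "closed \<O>" "\<O> \<subseteq> X"
    and rel: "stable_rel X f \<O> \<Gamma>" and attr: "attractive_rel X f \<O> \<Gamma>"
    and near: "locally_stable_near X f \<O> \<Gamma>"
    and x: "x \<in> \<Gamma>" and "0 < l" "0 < m"
    and ex: "\<And>x0. x0 \<in> pt_ball X l x \<Longrightarrow> {0..} \<subseteq> ex_ivl X f x0"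
    and conf: "\<And>x0 t. x0 \<in> pt_ball X l x \<Longrightarrow> 0 \<le> t \<Longrightarrow> infdist (flow X f t x0) \<Gamma> \<le> 1 \<Longrightarrow>
      flow X f t x0 \<in> pt_ball X m x"
    and \<epsilon>: "0 < \<epsilon>" "\<epsilon> \<le> 1"
  obtains d where "0 < d" "flow_into X f {0..} (pt_ball X d x) (set_ball X \<epsilon> \<Gamma>)"
proof (rule ccontr)
  assume no: "\<not> thesis"
  have "\<Gamma> \<noteq> {}" "\<O> \<noteq> {}" using x \<Gamma> by auto
  obtain N1 where N1: "nbhd X \<Gamma> N1" "flow_into X f {0..} (N1 \<inter> \<O>) (set_ball X (\<epsilon> / 2) \<Gamma>)"
    using rel \<epsilon> unfolding stable_rel_def by (metis half_gt_zero)
  obtain N2 where N2: "nbhd X \<Gamma> N2" "\<And>y. y \<in> N2 \<Longrightarrow> y \<in> \<O> \<Longrightarrow> tends_to_set X f y \<Gamma>"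
    using attr unfolding attractive_rel_def by blast
  have "nbhd X \<Gamma> (N1 \<inter> N2)" using N1 N2 by (auto simp: nbhd_def)
  then obtain \<delta>' where \<delta>': "0 < \<delta>'"
    "\<And>y. y \<in> X \<Longrightarrow> y \<in> cball x m \<Longrightarrow> infdist y \<Gamma> \<le> \<delta>' \<Longrightarrow> y \<in> N1 \<inter> N2"
    using nbhd_thick_on_compact[OF compact_cball \<Gamma>(1) \<open>\<Gamma> \<noteq> {}\<close>] by metis
  \<comment> \<open>\<open>\<delta>'\<close> puts limit points in the ball into
    \<open>N1 \<inter> N2\<close>; the other bound keeps the lower level strictly below
    \<open>\<epsilon>\<close>.\<close>
  define \<delta> where "\<delta> = min \<delta>' (\<epsilon> / 2)"
  have \<delta>: "0 < \<delta>" "\<delta> < \<epsilon>" using \<delta>' \<epsilon> by (auto simp: \<delta>_def)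
  \<comment> \<open>The three bounds give completeness and confinement, a start below level
    \<open>\<delta>\<close>, and convergence of the initial points to \<open>x\<close>.\<close>
  define d where "d n = min l (min \<delta> (inverse (Suc n)))" for n
  have d: "0 < d n" for n using \<delta> \<open>0 < l\<close> by (simp add: d_def)
  have escape: "\<exists>x0 s t. x0 \<in> pt_ball X (d n) x \<and> 0 \<le> s \<and> s < t \<and> infdist (flow X f s x0) \<Gamma> \<le> \<delta> \<and>
      infdist (flow X f t x0) \<Gamma> = \<epsilon> \<and> (\<forall>r. 0 \<le> r \<and> r \<le> t \<longrightarrow> infdist (flow X f r x0) \<Gamma> \<le> \<epsilon>) \<and>
      (\<forall>r. s < r \<and> r \<le> t \<longrightarrow> \<delta> < infdist (flow X f r x0) \<Gamma>)" for n
  proof -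
    have "\<not> flow_into X f {0..} (pt_ball X (d n) x) (set_ball X \<epsilon> \<Gamma>)" using no that d by blast
    then obtain x0 b where x0: "x0 \<in> pt_ball X (d n) x" "0 \<le> b"
      and nb: "\<not> (b \<in> ex_ivl X f x0 \<and> flow X f b x0 \<in> set_ball X \<epsilon> \<Gamma>)"
      unfolding flow_into_def by auto
    have e: "{0..} \<subseteq> ex_ivl X f x0" by (rule ex) (use x0 in \<open>auto simp: pt_ball_def d_def\<close>)
    have ge: "\<epsilon> \<le> infdist (flow X f b x0) \<Gamma>"
      using nb e x0 flow_in[OF e, of b] by (auto simp: set_ball_def)
    have "infdist x0 \<Gamma> \<le> dist x0 x" using x by (rule infdist_le)
    then have init: "infdist (flow X f 0 x0) \<Gamma> \<le> \<delta>"
      using x0 by (simp add: flow_zero[OF e] pt_ball_def d_def dist_norm)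
    have "continuous_on {0..b} (\<lambda>t. infdist (flow X f t x0) \<Gamma>)"
      by (intro continuous_intros continuous_on_subset[OF continuous_on_flow[OF e]]) auto
    from crossing_times[OF this \<open>0 \<le> b\<close> init \<delta>(2) ge] show ?thesis
      using x0(1) by metis
  qed
  obtain xs s t where xs: "\<And>n. xs n \<in> pt_ball X (d n) x"
    and st: "\<And>n. 0 \<le> s n" "\<And>n. s n < t n"
    and s: "\<And>n. infdist (flow X f (s n) (xs n)) \<Gamma> \<le> \<delta>"
    and t: "\<And>n. infdist (flow X f (t n) (xs n)) \<Gamma> = \<epsilon>"
    and le: "\<And>n r. 0 \<le> r \<Longrightarrow> r \<le> t n \<Longrightarrow> infdist (flow X f r (xs n)) \<Gamma> \<le> \<epsilon>"
    and gt: "\<And>n r. s n < r \<Longrightarrow> r \<le> t n \<Longrightarrow> \<delta> < infdist (flow X f r (xs n)) \<Gamma>"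
    using escape by metis
  have xsl: "xs n \<in> pt_ball X l x" for n using xs[of n] by (auto simp: pt_ball_def d_def)
  have e: "{0..} \<subseteq> ex_ivl X f (xs n)" for n using ex xsl by blast
  have into: "flow X f r (xs n) \<in> pt_ball X m x" if "0 \<le> r" "r \<le> t n" for n r
    using conf[OF xsl that(1)] le[OF that] \<epsilon> by simp
  define w where "w n = flow X f (s n) (xs n)" for n
  have ew: "{0..} \<subseteq> ex_ivl X f (w n)" for n unfolding w_def by (rule ex_ivl_flow[OF e st(1)])
  have "w n \<in> cball x m" for n
    using into[OF st(1), of n n] st(2)[of n] by (simp add: w_def pt_ball_def dist_norm norm_minus_commute)
  then obtain p r where p: "p \<in> cball x m" and r: "strict_mono (r :: nat \<Rightarrow> nat)" "(w \<circ> r) \<longlonglongrightarrow> p"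
    using compact_cball[of x m] unfolding compact_def by metis
  have "(\<lambda>n. infdist (w n) \<O>) \<longlonglongrightarrow> 0"
  proof (rule LIMSEQ_I)
    fix \<eta> :: real assume "0 < \<eta>"
    then obtain \<rho> where \<rho>: "0 < \<rho>" "\<And>x0 t. x0 \<in> set_ball X \<rho> \<Gamma> \<Longrightarrow> 0 < t \<Longrightarrow>
        flow_into X f {0..t} {x0} (pt_ball X m x) \<Longrightarrow> flow_into X f {0..t} {x0} (set_ball X \<eta> \<O>)"
      using near x \<open>0 < m\<close> unfolding locally_stable_near_def by metis
    obtain n0 where n0: "inverse (Suc n0) < \<rho>" using reals_Archimedean[OF \<rho>(1)] by auto
    have "norm (infdist (w n) \<O> - 0) < \<eta>" if "n \<ge> n0" for n
    proof -
      have "infdist (xs n) \<Gamma> \<le> dist (xs n) x" using x by (rule infdist_le)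
      also have "\<dots> < inverse (Suc n)" using xs[of n] by (simp add: pt_ball_def d_def dist_norm)
      also have "\<dots> \<le> inverse (Suc n0)" using that by (intro le_imp_inverse_le) auto
      finally have "xs n \<in> set_ball X \<rho> \<Gamma>" using n0 xs[of n] by (auto simp: set_ball_def pt_ball_def)
      \<comment> \<open>Local stability is applied on \<open>{0..t n}\<close> and evaluated at
        \<open>s n\<close>: it asks for a positive final time, and \<open>s n\<close> may be
        0.\<close>
      moreover have "0 < t n" using st[of n] by simp
      moreover have "flow_into X f {0..t n} {xs n} (pt_ball X m x)"
        using e[of n] into by (auto simp: flow_into_def)
      ultimately have "flow_into X f {0..t n} {xs n} (set_ball X \<eta> \<O>)" by (rule \<rho>(2))
      then show ?thesis using st[of n] by (auto simp: flow_into_def w_def set_ball_def infdist_nonneg)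
    qed
    then show "\<exists>n0. \<forall>n\<ge>n0. norm (infdist (w n) \<O> - 0) < \<eta>" by blast
  qed
  from tendsto_infdist_zero_in[OF \<O>(1) \<open>\<O> \<noteq> {}\<close> r(2)] LIMSEQ_subseq_LIMSEQ[OF this r(1)]
  have "p \<in> \<O>" by (simp add: o_def)
  have "infdist p \<Gamma> \<le> \<delta>"
    by (rule LIMSEQ_le_const2[OF tendsto_infdist[OF r(2)]]) (use s in \<open>auto simp: w_def\<close>)
  with \<delta>'(2)[of p] p \<open>p \<in> \<O>\<close> \<O>(2) have pN: "p \<in> N1" "p \<in> N2" by (auto simp: \<delta>_def)
  have pe: "{0..} \<subseteq> ex_ivl X f p" and plim: "((\<lambda>t. infdist (flow X f t p) \<Gamma>) \<longlongrightarrow> 0) at_top"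
    using N2(2)[OF pN(2) \<open>p \<in> \<O>\<close>] by (auto simp: tends_to_set_def)
  have half: "infdist (flow X f t p) \<Gamma> < \<epsilon> / 2" if "0 \<le> t" for t
    using N1(2) pN(1) \<open>p \<in> \<O>\<close> that by (auto simp: flow_into_def set_ball_def)
  \<comment> \<open>A positive \<open>T\<close> makes \<open>s n + T\<close> lie strictly after
    \<open>s n\<close>, where \<open>gt\<close> applies.\<close>
  have "\<forall>\<^sub>F t in at_top. infdist (flow X f t p) \<Gamma> < \<delta> \<and> 1 \<le> t"
    using order_tendstoD(2)[OF plim \<delta>(1)] eventually_ge_at_top by (rule eventually_conj)
  then obtain T where T: "infdist (flow X f T p) \<Gamma> < \<delta>" "1 \<le> T"
    using eventually_happens'[OF trivial_limit_at_top_linorder] by blast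
  \<comment> \<open>The first bound excludes level \<open>\<epsilon>\<close> within time
    \<open>T\<close> after \<open>s n\<close>; the second forces the trajectory below
    \<open>\<delta>\<close> at \<open>s n + T\<close>.\<close>
  define e0 where "e0 = min (\<epsilon> / 2) (\<delta> - infdist (flow X f T p) \<Gamma>)"
  have "0 < e0" "0 \<le> T" using T \<epsilon> by (simp_all add: e0_def)
  obtain \<rho> where \<rho>: "0 < \<rho>" "\<And>y t. {0..} \<subseteq> ex_ivl X f y \<Longrightarrow> dist p y < \<rho> \<Longrightarrow> 0 \<le> t \<Longrightarrow> t \<le> T \<Longrightarrow>
      dist (flow X f t p) (flow X f t y) < e0"
    using flow_continuous_dependence[OF pe \<open>0 \<le> T\<close> \<open>0 < e0\<close>] by blast
  obtain n where n: "dist p (w n) < \<rho>"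
    using tendstoD[OF r(2) \<rho>(1)] by (auto simp: eventually_sequentially dist_commute)
  have close: "infdist (flow X f (s n + t) (xs n)) \<Gamma> < infdist (flow X f t p) \<Gamma> + e0"
    if "0 \<le> t" "t \<le> T" for t
  proof -
    have "infdist (flow X f t (w n)) \<Gamma> \<le> infdist (flow X f t p) \<Gamma> + dist (flow X f t (w n)) (flow X f t p)"
      by (rule infdist_triangle)
    then show ?thesis
      using \<rho>(2)[OF ew n that] flow_flow[OF e st(1) that(1), of n n] by (simp add: w_def dist_commute)
  qed
  \<comment> \<open>One sufficiently close \<open>w n\<close> suffices: either \<open>t n\<close>
    comes within time \<open>T\<close> of \<open>s n\<close>, or the trajectory is back below
    \<open>\<delta>\<close> before \<open>t n\<close>.\<close>
  show False
  proof (cases "t n - s n \<le> T")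
    case True
    then show False using close[of "t n - s n"] half[of "t n - s n"] t[of n] st(2)[of n] by (simp add: e0_def)
  next
    case False
    then show False using close[of T] gt[of n "s n + T"] T by (simp add: e0_def)
  qed
qed

section \<open>Attractivity, confinement and the reduction results\<close>

text \<open>A limit point \<open>p\<close> of the trajectory lies in \<open>\<O>\<close>, hence is attracted to \<open>\<Gamma>\<close>; the trajectory
  follows that of \<open>p\<close> into a small neighbourhood of \<open>\<Gamma>\<close>, where stability traps it.\<close>

lemma tends_to_set_if_stable:
  assumes \<Gamma>: "closed \<Gamma>" "\<Gamma> \<noteq> {}" and \<O>: "closed \<O>" "\<O> \<noteq> {}"
    and stable: "stable X f \<Gamma>"
    and toO: "tends_to_set X f x0 \<O>"
    and C: "compact C" "\<And>t. 0 \<le> t \<Longrightarrow> flow X f t x0 \<in> C"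
    and lim: "\<And>p s. p \<in> C \<Longrightarrow> p \<in> \<O> \<Longrightarrow> (\<And>n. 0 \<le> s n) \<Longrightarrow>
      (\<lambda>n::nat. flow X f (s n) x0) \<longlonglongrightarrow> p \<Longrightarrow> tends_to_set X f p \<Gamma>"
  shows "tends_to_set X f x0 \<Gamma>"
proof -
  have e: "{0..} \<subseteq> ex_ivl X f x0" and limO: "((\<lambda>t. infdist (flow X f t x0) \<O>) \<longlongrightarrow> 0) at_top"
    using toO by (auto simp: tends_to_set_def)
  obtain p r where p: "p \<in> C" and r: "strict_mono (r :: nat \<Rightarrow> nat)"
    and rp: "((\<lambda>n. flow X f (real n) x0) \<circ> r) \<longlonglongrightarrow> p"
  proof (rule seq_compactE[OF compact_imp_seq_compact[OF C(1)]])
    show "\<forall>n. flow X f (real n) x0 \<in> C" using C(2) by simp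
  qed
  have "(\<lambda>n. infdist (flow X f (real n) x0) \<O>) \<longlonglongrightarrow> 0"
    by (rule filterlim_compose[OF limO filterlim_real_sequentially])
  from tendsto_infdist_zero_in[OF \<O> rp] LIMSEQ_subseq_LIMSEQ[OF this r]
  have "p \<in> \<O>" by (simp add: o_def)
  \<comment> \<open>\<open>lim\<close> is discharged locally by keeping \<open>p\<close> in the
    relative domain of attraction, globally by attraction on all of \<open>\<O>\<close>.\<close>
  have "tends_to_set X f p \<Gamma>"
    by (rule lim[OF p \<open>p \<in> \<O>\<close>, of "\<lambda>n. real (r n)"]) (use rp in \<open>auto simp: o_def\<close>)
  then have pe: "{0..} \<subseteq> ex_ivl X f p" and plim: "((\<lambda>t. infdist (flow X f t p) \<Gamma>) \<longlongrightarrow> 0) at_top"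
    by (auto simp: tends_to_set_def)
  have "\<forall>\<^sub>F t in at_top. infdist (flow X f t x0) \<Gamma> < \<eta>" if \<eta>: "0 < \<eta>" for \<eta>
  proof -
    obtain N where N: "nbhd X \<Gamma> N" "flow_into X f {0..} N (set_ball X \<eta> \<Gamma>)"
      using stable \<eta> unfolding stable_def by metis
    obtain d where d: "0 < d" "\<And>y. y \<in> X \<Longrightarrow> y \<in> C \<Longrightarrow> infdist y \<Gamma> \<le> d \<Longrightarrow> y \<in> N"
      using nbhd_thick_on_compact[OF C(1) \<Gamma> N(1)] by metis
    \<comment> \<open>Half of \<open>d\<close> is for the trajectory of \<open>p\<close>, half for
      the error of following it.\<close>
    have "\<forall>\<^sub>F t in at_top. infdist (flow X f t p) \<Gamma> < d / 2 \<and> 0 \<le> t"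
      using order_tendstoD(2)[OF plim half_gt_zero[OF d(1)]] eventually_ge_at_top by (rule eventually_conj)
    then obtain T where T: "infdist (flow X f T p) \<Gamma> < d / 2" "0 \<le> T"
      using eventually_happens'[OF trivial_limit_at_top_linorder] by blast
    obtain \<rho> where \<rho>: "0 < \<rho>" "\<And>y t. {0..} \<subseteq> ex_ivl X f y \<Longrightarrow> dist p y < \<rho> \<Longrightarrow> 0 \<le> t \<Longrightarrow> t \<le> T \<Longrightarrow>
        dist (flow X f t p) (flow X f t y) < d / 2"
      using flow_continuous_dependence[OF pe T(2) half_gt_zero[OF d(1)]] by blast
    obtain n where n: "dist p (flow X f (real n) x0) < \<rho>"
      using tendstoD[OF rp \<rho>(1)] by (auto simp: eventually_sequentially dist_commute)
    define b where "b = real n + T"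
    have "0 \<le> b" using T by (simp add: b_def)
    have "infdist (flow X f b x0) \<Gamma> \<le> infdist (flow X f T p) \<Gamma> + dist (flow X f b x0) (flow X f T p)"
      by (rule infdist_triangle)
    then have "infdist (flow X f b x0) \<Gamma> \<le> d"
      using \<rho>(2)[OF ex_ivl_flow[OF e] n T(2)] flow_flow[OF e _ T(2), of "real n"] T
      by (simp add: b_def dist_commute)
    then have bN: "flow X f b x0 \<in> N" using d(2) flow_in[OF e] C(2) \<open>0 \<le> b\<close> by blast
    have "infdist (flow X f t x0) \<Gamma> < \<eta>" if "b \<le> t" for t
    proof -
      have "infdist (flow X f (t - b) (flow X f b x0)) \<Gamma> < \<eta>"
        using N(2) bN that by (auto simp: flow_into_def set_ball_def)
      then show ?thesis using flow_flow[OF e \<open>0 \<le> b\<close>, of "t - b"] that by simp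
    qed
    then show ?thesis by (auto simp: eventually_at_top_linorder)
  qed
  then have "((\<lambda>t. infdist (flow X f t x0) \<Gamma>) \<longlongrightarrow> 0) at_top"
    by (intro order_tendstoI) (auto intro: always_eventually less_le_trans[OF _ infdist_nonneg])
  with e show ?thesis by (simp add: tends_to_set_def)
qed

text \<open>For bounded \<open>\<Gamma>\<close> the tube of radius 1 around it is itself bounded;
  otherwise local uniform boundedness provides the ball.\<close>

lemma trajectories_confined:
  assumes "closed \<Gamma>" and N: "nbhd X \<Gamma> N" "\<And>x0. x0 \<in> N \<Longrightarrow> {0..} \<subseteq> ex_ivl X f x0"
    and lub: "\<not> bounded \<Gamma> \<Longrightarrow> locally_uniformly_bounded_near X f \<Gamma>"
    and x: "x \<in> \<Gamma>"
  obtains l m where "0 < l" "0 < m" "pt_ball X l x \<subseteq> N"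
    "\<And>x0 t. x0 \<in> pt_ball X l x \<Longrightarrow> 0 \<le> t \<Longrightarrow> infdist (flow X f t x0) \<Gamma> \<le> 1 \<Longrightarrow>
       flow X f t x0 \<in> pt_ball X m x"
proof -
  obtain G where G: "open G" "N = X \<inter> G" "x \<in> G"
    using N(1) x unfolding nbhd_def openin_open by blast
  then obtain l0 where "0 < l0" "ball x l0 \<subseteq> G" using openE[OF G(1,3)] by blast
  then have l0: "0 < l0" "pt_ball X l0 x \<subseteq> N"
    using G by (auto simp: pt_ball_def subset_iff dist_norm norm_minus_commute)
  show thesis
  proof (cases "bounded \<Gamma>")
    case True
    then obtain B where B: "\<And>y. y \<in> \<Gamma> \<Longrightarrow> dist x y \<le> B" by (metis bounded_any_center)
    \<comment> \<open>The nearest point of \<open>\<Gamma>\<close> is within \<open>B\<close> of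
      \<open>x\<close> and within 1 of \<open>y\<close>; the second unit makes the inequality
      strict.\<close>
    have far: "dist x y < B + 2" if "infdist y \<Gamma> \<le> 1" for y
    proof -
      obtain z where z: "z \<in> \<Gamma>" "infdist y \<Gamma> = dist y z"
        using infdist_attains_inf[OF assms(1)] x by blast
      then show ?thesis using that B[OF z(1)] dist_triangle[of x y z] by (simp add: dist_commute)
    qed
    have "0 < B + 2" using B[OF x] by simp
    then show thesis
    proof (rule that[OF l0(1) _ l0(2)])
      fix x0 t assume *: "x0 \<in> pt_ball X l0 x" "0 \<le> t" "infdist (flow X f t x0) \<Gamma> \<le> 1"
      then show "flow X f t x0 \<in> pt_ball X (B + 2) x"
        using far[OF *(3)] flow_in[OF N(2)] l0(2) by (auto simp: pt_ball_def dist_norm norm_minus_commute)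
    qed
  next
    case False
    with lub x obtain l m where lm: "0 < l" "0 < m" "flow_into X f {0..} (pt_ball X l x) (pt_ball X m x)"
      unfolding locally_uniformly_bounded_near_def by blast
    show thesis
      by (rule that[of "min l l0" m]) (use lm l0 in \<open>auto simp: flow_into_def pt_ball_def\<close>)
  qed
qed

text \<open>Stability asks for a neighbourhood, not a uniform tube, so the radius may depend on
  \<open>x\<close>: the union of the balls works. Large \<open>\<epsilon>\<close> reduces to 1 by
  monotonicity.\<close>

lemma stableI_near_points:
  assumes "\<Gamma> \<subseteq> X"
    and ex: "\<And>x \<epsilon>. x \<in> \<Gamma> \<Longrightarrow> 0 < \<epsilon> \<Longrightarrow> \<epsilon> \<le> 1 \<Longrightarrow>
      \<exists>d>0. flow_into X f {0..} (pt_ball X d x) (set_ball X \<epsilon> \<Gamma>)"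
  shows "stable X f \<Gamma>"
  unfolding stable_def
proof (intro allI impI)
  fix \<epsilon> :: real assume "0 < \<epsilon>"
  then have "\<forall>x\<in>\<Gamma>. \<exists>d>0. flow_into X f {0..} (pt_ball X d x) (set_ball X (min \<epsilon> 1) \<Gamma>)"
    using ex[of _ "min \<epsilon> 1"] by auto
  then obtain d where d: "\<And>x. x \<in> \<Gamma> \<Longrightarrow> 0 < d x"
    "\<And>x. x \<in> \<Gamma> \<Longrightarrow> flow_into X f {0..} (pt_ball X (d x) x) (set_ball X (min \<epsilon> 1) \<Gamma>)"
    by metis
  have ball: "pt_ball X r x = X \<inter> ball x r" for r x
    by (auto simp: pt_ball_def dist_norm norm_minus_commute)
  have "nbhd X \<Gamma> (\<Union>x\<in>\<Gamma>. pt_ball X (d x) x)"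
    unfolding nbhd_def ball using d(1) assms(1) by (auto intro!: openin_Union openin_open_Int)
  moreover have "flow_into X f {0..} (\<Union>x\<in>\<Gamma>. pt_ball X (d x) x) (set_ball X \<epsilon> \<Gamma>)"
    using d(2) by (fastforce simp: flow_into_def set_ball_def)
  ultimately show "\<exists>N. nbhd X \<Gamma> N \<and> flow_into X f {0..} N (set_ball X \<epsilon> \<Gamma>)" by blast
qed

text \<open>Local attractivity of \<open>\<O>\<close> supplies forward completeness near
  \<open>\<Gamma>\<close>, which with confinement reduces the claim to single points.\<close>

lemma stable_by_reduction:
  assumes \<Gamma>: "closed \<Gamma>" "\<Gamma> \<subseteq> \<O>" and \<O>: "closed \<O>" "\<O> \<subseteq> X"
    and rel: "asymptotically_stable_rel X f \<O> \<Gamma>"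
    and near: "locally_stable_near X f \<O> \<Gamma>"
    and attr: "locally_attractive_near X f \<O> \<Gamma>"
    and lub: "\<not> bounded \<Gamma> \<Longrightarrow> locally_uniformly_bounded_near X f \<Gamma>"
  shows "stable X f \<Gamma>"
proof (rule stableI_near_points)
  show "\<Gamma> \<subseteq> X" using assms by auto
  fix x \<epsilon> assume x: "x \<in> \<Gamma>" and \<epsilon>: "(0::real) < \<epsilon>" "\<epsilon> \<le> 1"
  obtain N where N: "nbhd X \<Gamma> N" "\<And>x0. x0 \<in> N \<Longrightarrow> {0..} \<subseteq> ex_ivl X f x0"
    using attr unfolding locally_attractive_near_def tends_to_set_def by blast
  obtain l m where lm: "0 < l" "0 < m" "pt_ball X l x \<subseteq> N"
    "\<And>x0 t. x0 \<in> pt_ball X l x \<Longrightarrow> 0 \<le> t \<Longrightarrow> infdist (flow X f t x0) \<Gamma> \<le> 1 \<Longrightarrow>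
       flow X f t x0 \<in> pt_ball X m x"
    using trajectories_confined[OF \<Gamma>(1) N lub x] by blast
  obtain d where "0 < d" "flow_into X f {0..} (pt_ball X d x) (set_ball X \<epsilon> \<Gamma>)"
    by (rule stable_near_point[OF \<Gamma> \<O> _ _ near x lm(1,2) _ lm(4) \<epsilon>])
       (use rel N(2) lm(3) in \<open>auto simp: asymptotically_stable_rel_def\<close>)
  then show "\<exists>d>0. flow_into X f {0..} (pt_ball X d x) (set_ball X \<epsilon> \<Gamma>)" by blast
qed

text \<open>Near each point of \<open>\<Gamma>\<close>, trajectories lie in a compact ball and, by
  stability, so close to \<open>\<Gamma>\<close> that their limit points belong to
  \<open>N2\<close>. The resulting neighbourhoods of points are then united.\<close>

lemma attractive_by_reduction:
  assumes \<Gamma>: "closed \<Gamma>" "\<Gamma> \<subseteq> \<O>" and \<O>: "closed \<O>" "\<O> \<subseteq> X"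
    and rel: "attractive_rel X f \<O> \<Gamma>"
    and stable: "stable X f \<Gamma>"
    and attr: "locally_attractive_near X f \<O> \<Gamma>"
    and lub: "\<not> bounded \<Gamma> \<Longrightarrow> locally_uniformly_bounded_near X f \<Gamma>"
  shows "attractive X f \<Gamma>"
proof -
  obtain N where N: "nbhd X \<Gamma> N" "\<And>x0. x0 \<in> N \<Longrightarrow> tends_to_set X f x0 \<O>"
    using attr unfolding locally_attractive_near_def by blast
  obtain N2 where N2: "nbhd X \<Gamma> N2" "\<And>y. y \<in> N2 \<Longrightarrow> y \<in> \<O> \<Longrightarrow> tends_to_set X f y \<Gamma>"
    using rel unfolding attractive_rel_def by blast
  have "\<exists>M. openin (top_of_set X) M \<and> x \<in> M \<and> (\<forall>x0\<in>M. tends_to_set X f x0 \<Gamma>)" if x: "x \<in> \<Gamma>" for x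
  proof -
    have "\<Gamma> \<noteq> {}" "\<O> \<noteq> {}" using x \<Gamma> by auto
    have ex: "{0..} \<subseteq> ex_ivl X f x0" if "x0 \<in> N" for x0 using N(2)[OF that] by (simp add: tends_to_set_def)
    obtain l m where lm: "0 < l" "0 < m" "pt_ball X l x \<subseteq> N"
      "\<And>x0 t. x0 \<in> pt_ball X l x \<Longrightarrow> 0 \<le> t \<Longrightarrow> infdist (flow X f t x0) \<Gamma> \<le> 1 \<Longrightarrow>
         flow X f t x0 \<in> pt_ball X m x"
      using trajectories_confined[OF \<Gamma>(1) N(1) ex lub x] by blast
    obtain d where d: "0 < d"
      "\<And>y. y \<in> X \<Longrightarrow> y \<in> cball x m \<Longrightarrow> infdist y \<Gamma> \<le> d \<Longrightarrow> y \<in> N2"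
      using nbhd_thick_on_compact[OF compact_cball \<Gamma>(1) \<open>\<Gamma> \<noteq> {}\<close> N2(1)] by metis
    \<comment> \<open>Distance \<open>d\<close> puts limit points into \<open>N2\<close>; distance 1
      triggers the confinement \<open>lm(4)\<close>.\<close>
    obtain M where M: "nbhd X \<Gamma> M" "flow_into X f {0..} M (set_ball X (min d 1) \<Gamma>)"
      using stable d(1) unfolding stable_def by (metis min_less_iff_conj zero_less_one)
    have ball: "pt_ball X l x = X \<inter> ball x l" by (auto simp: pt_ball_def dist_norm norm_minus_commute)
    have "tends_to_set X f x0 \<Gamma>" if x0: "x0 \<in> M" "x0 \<in> pt_ball X l x" for x0
    proof (rule tends_to_set_if_stable[OF \<Gamma>(1) \<open>\<Gamma> \<noteq> {}\<close> \<O>(1) \<open>\<O> \<noteq> {}\<close> stable N(2) compact_cball])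
      show "x0 \<in> N" using x0 lm by auto
      have close: "infdist (flow X f t x0) \<Gamma> < min d 1" if "0 \<le> t" for t
        using M(2) x0(1) that unfolding flow_into_def set_ball_def by auto
      show "flow X f t x0 \<in> cball x m" if "0 \<le> t" for t
        using lm(4)[OF x0(2) that] close[OF that] by (simp add: pt_ball_def dist_norm norm_minus_commute)
      fix p and s :: "nat \<Rightarrow> real"
      assume p: "p \<in> cball x m" "p \<in> \<O>" "\<And>n. 0 \<le> s n" "(\<lambda>n. flow X f (s n) x0) \<longlonglongrightarrow> p"
      have "infdist p \<Gamma> \<le> d"
        by (rule LIMSEQ_le_const2[OF tendsto_infdist[OF p(4)]]) (use close[OF p(3)] in \<open>auto intro: less_imp_le\<close>)
      then show "tends_to_set X f p \<Gamma>" using p d(2) N2(2) \<O>(2) by blast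
    qed
    moreover have "openin (top_of_set X) (M \<inter> pt_ball X l x)"
      using M(1) unfolding nbhd_def ball by (intro openin_Int openin_open_Int) auto
    moreover have "x \<in> M \<inter> pt_ball X l x"
      using M(1) x lm(1) \<Gamma>(2) \<O>(2) unfolding nbhd_def ball by auto
    ultimately show ?thesis by blast
  qed
  then obtain M where M: "\<And>x. x \<in> \<Gamma> \<Longrightarrow> openin (top_of_set X) (M x) \<and> x \<in> M x"
    "\<And>x x0. x \<in> \<Gamma> \<Longrightarrow> x0 \<in> M x \<Longrightarrow> tends_to_set X f x0 \<Gamma>" by metis
  have "nbhd X \<Gamma> (\<Union>x\<in>\<Gamma>. M x)" using M(1) by (auto simp: nbhd_def)
  with M(2) show ?thesis unfolding attractive_def by blast
qed

text \<open>The closure of a bounded trajectory takes the place of the compact ball, and all its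
  points in \<open>\<O>\<close> are attracted to \<open>\<Gamma>\<close>.\<close>

lemma globally_attractive_by_reduction:
  assumes \<Gamma>: "closed \<Gamma>" "\<Gamma> \<noteq> {}" "\<Gamma> \<subseteq> \<O>" and \<O>: "closed \<O>" "\<O> \<subseteq> X"
    and rel: "globally_attractive_rel X f \<O> \<Gamma>"
    and stable: "stable X f \<Gamma>"
    and attr: "globally_attractive X f \<O>"
    and bdd: "all_trajectories_bounded X f"
  shows "globally_attractive X f \<Gamma>"
  unfolding globally_attractive_def
proof
  fix x0 assume x0: "x0 \<in> X"
  let ?C = "closure ((\<lambda>t. flow X f t x0) ` (ex_ivl X f x0 \<inter> {0..}))"
  have toO: "tends_to_set X f x0 \<O>" using attr x0 by (simp add: globally_attractive_def)
  have "bounded ((\<lambda>t. flow X f t x0) ` (ex_ivl X f x0 \<inter> {0..}))"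
    using bdd x0 unfolding all_trajectories_bounded_def by blast
  then have "compact ?C" by (simp add: compact_closure)
  moreover have "flow X f t x0 \<in> ?C" if "0 \<le> t" for t
    using toO that by (intro closure_subset[THEN subsetD] imageI) (auto simp: tends_to_set_def)
  moreover have "tends_to_set X f p \<Gamma>" if "p \<in> \<O>" for p
    using rel that \<O>(2) unfolding globally_attractive_rel_def by blast
  moreover have "\<O> \<noteq> {}" using \<Gamma> by auto
  ultimately show "tends_to_set X f x0 \<Gamma>"
    using tends_to_set_if_stable[OF \<Gamma>(1,2) \<O>(1) _ stable toO, of ?C] by blast
qed

end

theorem theorem3p2:
  fixes X \<Gamma> \<O> :: "(real ^ 'n) set" and f :: "real ^ 'n \<Rightarrow> real ^ 'n"
  assumes "open X \<or> smooth_submanifold X"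
    and "loc_lipschitz_vector_field X f"
    and "closed \<Gamma>" and "closed \<O>" and "\<Gamma> \<noteq> {}"
    and "\<Gamma> \<subseteq> \<O>" and "\<O> \<subseteq> X"
    and "positively_invariant X f \<Gamma>" and "positively_invariant X f \<O>"
  shows
    "(asymptotically_stable_rel X f \<O> \<Gamma> \<and>
      locally_stable_near X f \<O> \<Gamma> \<and>
      locally_attractive_near X f \<O> \<Gamma> \<and>
      (\<not> bounded \<Gamma> \<longrightarrow> locally_uniformly_bounded_near X f \<Gamma>)
      \<longrightarrow> asymptotically_stable X f \<Gamma>) \<and>
     (globally_asymptotically_stable_rel X f \<O> \<Gamma> \<and>
      locally_stable_near X f \<O> \<Gamma> \<and>
      globally_attractive X f \<O> \<and>
      (\<not> bounded \<Gamma> \<longrightarrow> locally_uniformly_bounded_near X f \<Gamma>) \<and>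
      all_trajectories_bounded X f
      \<longrightarrow> globally_asymptotically_stable X f \<Gamma>)"
proof -
  have lip: "local_lipschitz (UNIV :: real set) X (\<lambda>_. f)"
    using assms(2) by (simp add: loc_lipschitz_vector_field_def)
  \<comment> \<open>With \<open>X\<close> as the neighbourhood, the global hypotheses imply the
    local ones, so stability in the global version follows from the local argument.\<close>
  have "nbhd X \<Gamma> X" using assms by (auto simp: nbhd_def)
  then have "locally_attractive_near X f \<O> \<Gamma>" if "globally_attractive X f \<O>"
    using that unfolding locally_attractive_near_def globally_attractive_def by blast
  moreover have "asymptotically_stable_rel X f \<O> \<Gamma>" if "globally_asymptotically_stable_rel X f \<O> \<Gamma>"
    using that \<open>nbhd X \<Gamma> X\<close>
    unfolding asymptotically_stable_rel_def globally_asymptotically_stable_rel_def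
      attractive_rel_def globally_attractive_rel_def by blast
  ultimately show ?thesis
    using stable_by_reduction[OF lip assms(3,6,4,7)] attractive_by_reduction[OF lip assms(3,6,4,7)]
      globally_attractive_by_reduction[OF lip assms(3,5,6,4,7)]
    unfolding asymptotically_stable_def globally_asymptotically_stable_def
      globally_asymptotically_stable_rel_def
    by (metis asymptotically_stable_rel_def)
qed

end
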